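(* Let $n=6$ and let $\boldsymbol v^0$ be the sextuple-periodic field of the context at the symmetric phases $\boldsymbol\xi=(-\tfrac{\pi}{4},\tfrac{\pi}{4},\tfrac{\pi}{4},\tfrac{\pi}{4},\tfrac{\pi}{4},\tfrac{\pi}{4})$. With $s_k=\sin(2\alpha x_k)$ let $$p^*(\boldsymbol x)=\frac{\rho v_r^2}{16}\Big[s_1s_3(1-s_2s_5)+s_1s_5(1-s_3s_4)+s_2s_4(1-s_5s_6)+s_2s_6(1-s_3s_4)+s_3s_5(1-s_1s_6)+s_4s_6(1-s_1s_2)\Big],$$ and let $\boldsymbol g^0=(\boldsymbol v^0\cdot\nabla)\boldsymbol v^0$. Define the body-force amplitude $$f_i^0(\boldsymbol x)=\frac1\rho\frac{\partial p^*}{\partial x_i}+g_i^0(\boldsymbol x)=-\frac{\alpha v_r^2}{4}\cos(2\alpha x_i)\prod_{j=1}^{3}\sin\big(2\alpha x_{\langle i+2j-1\rangle}\big),\qquad i=1,\dots,6,$$ the second equality being part of the assertion. Then the velocity $\boldsymbol v(\boldsymbol x,t)=\boldsymbol v^0(\boldsymbol x)e^{-6\alpha^2\kappa t}$ together with the pressure $p(\boldsymbol x,t)=p^*(\boldsymbol x)e^{-12\alpha^2\kappa t}$ is an exact solution of the incompressible Navier--Stokes equations on $\mathbb R^6$, $t\ge0$, under the body force $\boldsymbol f(\boldsymbol x,t)=\boldsymbol f^0(\boldsymbol x)e^{-12\alpha^2\kappa t}$.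
   Context: Fix $\alpha>0$, $v_r>0$, density $\rho>0$, viscosity $\kappa>0$; $\langle m\rangle=((m-1)\bmod 6)+1$. The first component of the field is $$\frac{v_1^0}{v_r}=\sin(\alpha x_1+\xi_1)\cos(\alpha x_2+\xi_2)\sin(\alpha x_3+\xi_3)\cos(\alpha x_4+\xi_4)\sin(\alpha x_5+\xi_5)\cos(\alpha x_6+\xi_6)$$ $$-\sin(\alpha x_1+\xi_2)\sin(\alpha x_2+\xi_3)\cos(\alpha x_3+\xi_4)\sin(\alpha x_4+\xi_5)\cos(\alpha x_5+\xi_6)\cos(\alpha x_6+\xi_1),$$ and $v_i^0$ is obtained from $v_1^0$ by the cyclic coordinate permutation $x_j\mapsto x_{\langle i+j-1\rangle}$ with the same $\boldsymbol\xi$. The incompressible Navier--Stokes equations are $\partial_tv_i+\sum_jv_j\partial_jv_i=\kappa\Delta v_i-\rho^{-1}\partial_ip+f_i$ for all $i$, and $\nabla\cdot\boldsymbol v=0$. *)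

theory Defs
  imports "HOL-Analysis.Analysis"
begin

section \<open>Partial derivatives and classical solutions\<close>

definition partial_deriv :: "'n::finite \<Rightarrow> (real ^ 'n \<Rightarrow> real) \<Rightarrow> real ^ 'n \<Rightarrow> real" where
  "partial_deriv j f x = deriv (\<lambda>h. f (x + h *\<^sub>R axis j 1)) 0"

definition has_partial :: "'n::finite \<Rightarrow> (real ^ 'n \<Rightarrow> real) \<Rightarrow> real ^ 'n \<Rightarrow> bool" where
  "has_partial j f x \<longleftrightarrow> (\<lambda>h. f (x + h *\<^sub>R axis j 1)) field_differentiable at 0"

text \<open>The time domain is \<open>t \<ge> 0\<close>, so the time derivative is one-sided at \<open>t = 0\<close>.\<close>

definition time_deriv :: "(real \<Rightarrow> real ^ 'n::finite \<Rightarrow> real) \<Rightarrow> real \<Rightarrow> real ^ 'n \<Rightarrow> real" where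
  "time_deriv u t x = vector_derivative (\<lambda>s. u s x) (at t within {0..})"

definition laplacian :: "(real ^ 'n::finite \<Rightarrow> real) \<Rightarrow> real ^ 'n \<Rightarrow> real" where
  "laplacian f x = (\<Sum>j\<in>UNIV. partial_deriv j (partial_deriv j f) x)"

definition divergence :: "(real ^ 'n::finite \<Rightarrow> real ^ 'n) \<Rightarrow> real ^ 'n \<Rightarrow> real" where
  "divergence v x = (\<Sum>j\<in>UNIV. partial_deriv j (\<lambda>y. v y $ j) x)"

text \<open>The vector field \<open>(v \<cdot> \<nabla>) v\<close>.\<close>

definition advection :: "(real ^ 'n::finite \<Rightarrow> real ^ 'n) \<Rightarrow> real ^ 'n \<Rightarrow> real ^ 'n" where
  "advection v x = (\<chi> i. \<Sum>j\<in>UNIV. v x $ j * partial_deriv j (\<lambda>y. v y $ i) x)"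

definition C1_in_space :: "(real \<Rightarrow> real ^ 'n::finite \<Rightarrow> real) \<Rightarrow> bool" where
  "C1_in_space u \<longleftrightarrow>
     continuous_on ({0..} \<times> UNIV) (\<lambda>(t, x). u t x) \<and>
     (\<forall>j. (\<forall>t\<ge>0. \<forall>x. has_partial j (u t) x) \<and>
          continuous_on ({0..} \<times> UNIV) (\<lambda>(t, x). partial_deriv j (u t) x))"

definition C1_in_time :: "(real \<Rightarrow> real ^ 'n::finite \<Rightarrow> real) \<Rightarrow> bool" where
  "C1_in_time u \<longleftrightarrow>
     (\<forall>t\<ge>0. \<forall>x. (\<lambda>s. u s x) differentiable (at t within {0..})) \<and>
     continuous_on ({0..} \<times> UNIV) (\<lambda>(t, x). time_deriv u t x)"

text \<open>Incompressible Navier--Stokes on all of \<open>\<real>\<^sup>n\<close> for \<open>t \<ge> 0\<close>, in the classical sense.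
  The regularity clauses guarantee that every derivative occurring in the equations exists
  (\<open>deriv\<close> and \<open>vector_derivative\<close> are total functions). The arguments are the density,
  the (kinematic) viscosity, the body force, the velocity and the pressure.\<close>

definition navier_stokes_solution ::
  "real \<Rightarrow> real \<Rightarrow> (real \<Rightarrow> real ^ 'n::finite \<Rightarrow> real ^ 'n) \<Rightarrow>
   (real \<Rightarrow> real ^ 'n \<Rightarrow> real ^ 'n) \<Rightarrow> (real \<Rightarrow> real ^ 'n \<Rightarrow> real) \<Rightarrow> bool" where
  "navier_stokes_solution \<rho> \<kappa> f v p \<longleftrightarrow>
     (\<forall>i. C1_in_time (\<lambda>t x. v t x $ i) \<and>
          C1_in_space (\<lambda>t x. v t x $ i) \<and>
          (\<forall>j. C1_in_space (\<lambda>t. partial_deriv j (\<lambda>x. v t x $ i)))) \<and>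
     C1_in_space p \<and>
     (\<forall>t\<ge>0. \<forall>x.
        (\<forall>i. time_deriv (\<lambda>s y. v s y $ i) t x + advection (v t) x $ i =
             \<kappa> * laplacian (\<lambda>y. v t y $ i) x - (1 / \<rho>) * partial_deriv i (p t) x + f t x $ i) \<and>
        divergence (v t) x = 0)"

section \<open>The sextuple-periodic field\<close>

text \<open>Coordinates of \<open>\<real>\<^sup>6\<close> are indexed by the numeral type \<open>6\<close>, whose arithmetic is modulo 6
  and whose elements are \<open>1, \<dots>, 6\<close> with \<open>6 = 0\<close>. Hence an index expression such as
  \<open>i + j - 1\<close> of type \<open>6\<close> is automatically reduced to
  \<open>\<langle>i + j - 1\<rangle>\<close>, where \<open>\<langle>m\<rangle> = ((m - 1) mod 6) + 1\<close>.\<close>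

definition v0_first :: "real \<Rightarrow> real \<Rightarrow> real ^ 6 \<Rightarrow> real ^ 6 \<Rightarrow> real" where
  "v0_first \<alpha> v\<^sub>r \<xi> x = v\<^sub>r *
     (sin (\<alpha> * x$1 + \<xi>$1) * cos (\<alpha> * x$2 + \<xi>$2) * sin (\<alpha> * x$3 + \<xi>$3) *
      cos (\<alpha> * x$4 + \<xi>$4) * sin (\<alpha> * x$5 + \<xi>$5) * cos (\<alpha> * x$6 + \<xi>$6)
    - sin (\<alpha> * x$1 + \<xi>$2) * sin (\<alpha> * x$2 + \<xi>$3) * cos (\<alpha> * x$3 + \<xi>$4) *
      sin (\<alpha> * x$4 + \<xi>$5) * cos (\<alpha> * x$5 + \<xi>$6) * cos (\<alpha> * x$6 + \<xi>$1))"

definition v0 :: "real \<Rightarrow> real \<Rightarrow> real ^ 6 \<Rightarrow> real ^ 6 \<Rightarrow> real ^ 6" where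
  "v0 \<alpha> v\<^sub>r \<xi> x = (\<chi> i. v0_first \<alpha> v\<^sub>r \<xi> (\<chi> j. x $ (i + j - 1)))"

definition symmetric_phases :: "real ^ 6" where
  "symmetric_phases = (\<chi> j. if j = 1 then - (pi / 4) else pi / 4)"

definition pstar :: "real \<Rightarrow> real \<Rightarrow> real \<Rightarrow> real ^ 6 \<Rightarrow> real" where
  "pstar \<rho> \<alpha> v\<^sub>r x = (let s = (\<lambda>k::6. sin (2 * \<alpha> * x$k)) in
     \<rho> * v\<^sub>r\<^sup>2 / 16 *
       (s 1 * s 3 * (1 - s 2 * s 5) + s 1 * s 5 * (1 - s 3 * s 4) +
        s 2 * s 4 * (1 - s 5 * s 6) + s 2 * s 6 * (1 - s 3 * s 4) +
        s 3 * s 5 * (1 - s 1 * s 6) + s 4 * s 6 * (1 - s 1 * s 2)))"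

definition f0 :: "real \<Rightarrow> real \<Rightarrow> real \<Rightarrow> real ^ 6 \<Rightarrow> real ^ 6" where
  "f0 \<rho> \<alpha> v\<^sub>r x =
     (\<chi> i. (1 / \<rho>) * partial_deriv i (pstar \<rho> \<alpha> v\<^sub>r) x
          + advection (v0 \<alpha> v\<^sub>r symmetric_phases) x $ i)"

end

theory Submission
  imports Defs
begin

text \<open>The viscous term and the nonlinear term of the Navier--Stokes equations can be balanced
  separately. Every component of the field is a combination of products
  \<open>\<Prod>k. sin (\<alpha> x\<^sub>k + \<phi>\<^sub>k)\<close>, a cosine being a sine whose phase is advanced by a quarter turn. Each
  such product is an eigenfunction of every \<open>\<partial>\<^sub>j\<^sup>2\<close> with eigenvalue \<open>- \<alpha>\<^sup>2\<close>, hence of the Laplacian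
  with eigenvalue \<open>- 6 \<alpha>\<^sup>2\<close>, so multiplication by \<open>exp (- 6 \<alpha>\<^sup>2 \<kappa> t)\<close> makes the time derivative equal to
  the viscous term. What remains in the momentum equation is quadratic in the velocity and therefore
  carries the factor \<open>exp (- 12 \<alpha>\<^sup>2 \<kappa> t)\<close> throughout; it holds by the very definition of the force as
  the sum of pressure gradient and advection. This is
  \<open>decaying_eigenfield_solves_navier_stokes\<close>, which is independent of the particular field.

  Incompressibility is a cyclic cancellation, valid for arbitrary phases: along its own axis, the
  first product of one component has the same derivative as the second product of the next
  component (\<open>v0_diagonal_phases\<close>), and the two products enter with opposite signs.

  The symmetric phases enter in the closed form of the force. There, with
  \<open>\<theta>\<^sub>k = \<alpha> x\<^sub>k + \<pi>/4\<close>, all phases collapse and the field becomes a polynomial in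
  \<open>S\<^sub>k = sin \<theta>\<^sub>k\<close> and \<open>C\<^sub>k = cos \<theta>\<^sub>k\<close>, while
  \<open>sin (2 \<alpha> x\<^sub>k) = S\<^sub>k\<^sup>2 - C\<^sub>k\<^sup>2\<close> and \<open>cos (2 \<alpha> x\<^sub>k) = 2 S\<^sub>k C\<^sub>k\<close>. The advection term is then evaluated by
  a polynomial identity (\<open>v0_product_identity\<close>). Comparing the result with the pressure gradient,
  the terms other than a multiple of the triple product at odd offsets cancel. Since the
  pressure is invariant and the field equivariant under cyclic shifts of the coordinates, every
  computation is carried out
  in indices \<open>i, i + 1, \<dots>, i + 5\<close> relative to the component \<open>i\<close>, which treats the six components
  at once.\<close>

section \<open>Partial derivatives\<close>

lemma partial_derivI:
  assumes "((\<lambda>h. f (x + h *\<^sub>R axis j 1)) has_field_derivative D) (at 0)"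
  shows "has_partial j f x" and "partial_deriv j f x = D"
  using assms
  by (auto simp: has_partial_def partial_deriv_def field_differentiable_def dest: DERIV_imp_deriv)

lemma partial_has_derivative:
  assumes "has_partial j f x"
  shows "((\<lambda>h. f (x + h *\<^sub>R axis j 1)) has_field_derivative partial_deriv j f x) (at 0)"
  using assms by (simp add: has_partial_def partial_deriv_def field_differentiable_derivI)

lemma has_partial_cmult: "has_partial j f x \<Longrightarrow> has_partial j (\<lambda>y. c * f y) x"
  and partial_deriv_cmult:
    "has_partial j f x \<Longrightarrow> partial_deriv j (\<lambda>y. c * f y) x = c * partial_deriv j f x"
  using partial_derivI[where f = "\<lambda>y. c * f y", OF DERIV_cmult[OF partial_has_derivative]]
  by auto

lemma has_partial_diff:
    "has_partial j f x \<Longrightarrow> has_partial j g x \<Longrightarrow> has_partial j (\<lambda>y. f y - g y) x"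
  and partial_deriv_diff:
    "has_partial j f x \<Longrightarrow> has_partial j g x \<Longrightarrow>
      partial_deriv j (\<lambda>y. f y - g y) x = partial_deriv j f x - partial_deriv j g x"
proof -
  assume "has_partial j f x" "has_partial j g x"
  then have "((\<lambda>h. f (x + h *\<^sub>R axis j 1) - g (x + h *\<^sub>R axis j 1)) has_field_derivative
      partial_deriv j f x - partial_deriv j g x) (at 0)"
    by (intro DERIV_diff partial_has_derivative)
  then show "has_partial j (\<lambda>y. f y - g y) x"
    and "partial_deriv j (\<lambda>y. f y - g y) x = partial_deriv j f x - partial_deriv j g x"
    by (auto dest: partial_derivI[where f = "\<lambda>y. f y - g y"])
qed

definition C1_fun :: "(real ^ 'n::finite \<Rightarrow> real) \<Rightarrow> bool" where
  "C1_fun f \<longleftrightarrow> continuous_on UNIV f \<and>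
     (\<forall>j. (\<forall>x. has_partial j f x) \<and> continuous_on UNIV (partial_deriv j f))"

lemma C1_fun_cmult:
  assumes "C1_fun f"
  shows "C1_fun (\<lambda>x. c * f x)"
proof -
  have "partial_deriv j (\<lambda>x. c * f x) = (\<lambda>x. c * partial_deriv j f x)" for j
    using assms by (auto simp: C1_fun_def partial_deriv_cmult)
  then show ?thesis
    using assms by (auto simp: C1_fun_def has_partial_cmult intro!: continuous_intros)
qed

lemma C1_fun_diff:
  assumes "C1_fun f" "C1_fun g"
  shows "C1_fun (\<lambda>x. f x - g x)"
proof -
  have "partial_deriv j (\<lambda>x. f x - g x) = (\<lambda>x. partial_deriv j f x - partial_deriv j g x)" for j
    using assms by (auto simp: C1_fun_def partial_deriv_diff)
  then show ?thesis
    using assms by (auto simp: C1_fun_def has_partial_diff intro!: continuous_intros)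
qed

section \<open>Separated solutions\<close>

lemma continuous_on_separated:
  fixes e :: "real \<Rightarrow> real" and f :: "'a::topological_space \<Rightarrow> real"
  assumes "continuous_on {0..} e" "continuous_on UNIV f"
  shows "continuous_on ({0..} \<times> UNIV) (\<lambda>(t, x). e t * f x)"
  unfolding case_prod_beta
  by (intro continuous_intros continuous_on_compose2[OF assms(1)] continuous_on_compose2[OF assms(2)])
     auto

lemma C1_in_space_separated:
  assumes e: "continuous_on {0..} e" and f: "C1_fun f"
  shows "C1_in_space (\<lambda>t x. e t * f x)"
proof -
  have "partial_deriv j (\<lambda>x. e t * f x) x = e t * partial_deriv j f x" for j t x
    using f by (auto simp: C1_fun_def partial_deriv_cmult)
  then show ?thesis
    using f by (auto simp: C1_in_space_def C1_fun_def
        intro!: continuous_on_separated[OF e] has_partial_cmult)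
qed

text \<open>At \<open>t = 0\<close> the derivative is one-sided; it is still unique because every \<open>t \<ge> 0\<close> is approached
  from the right within \<open>{0..}\<close>.\<close>

lemma time_deriv_exp_separated:
  assumes "t \<ge> 0"
  shows "(\<lambda>s. exp (c * s) * f x) differentiable (at t within {0..})"
    and "time_deriv (\<lambda>s y. exp (c * s) * f y) t x = c * exp (c * t) * f x"
proof -
  have "at t within {t<..} \<le> at t within {0..}"
    using assms by (intro at_le) auto
  then have nontrivial: "at t within {0..} \<noteq> bot"
    using trivial_limit_at_right_real[of t] by (metis bot.extremum_unique trivial_limit_def)
  have D: "((\<lambda>s. exp (c * s) * f x) has_vector_derivative c * exp (c * t) * f x) (at t within {0..})"
    unfolding has_real_derivative_iff_has_vector_derivative[symmetric]
    by (auto intro!: derivative_eq_intros)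
  show "(\<lambda>s. exp (c * s) * f x) differentiable (at t within {0..})"
    using D by (rule differentiableI_vector)
  show "time_deriv (\<lambda>s y. exp (c * s) * f y) t x = c * exp (c * t) * f x"
    unfolding time_deriv_def using D by (rule vector_derivative_within[OF nontrivial])
qed

lemma C1_in_time_exp_separated:
  assumes "continuous_on UNIV f"
  shows "C1_in_time (\<lambda>t x. exp (c * t) * f x)"
proof -
  have "continuous_on ({0..} \<times> UNIV) (\<lambda>(t, x). (c * exp (c * t)) * f x)"
    by (intro continuous_on_separated assms continuous_intros)
  then have "continuous_on ({0..} \<times> UNIV) (\<lambda>(t, x). time_deriv (\<lambda>t x. exp (c * t) * f x) t x)"
    by (rule continuous_on_eq) (auto simp: time_deriv_exp_separated)
  then show ?thesis
    by (simp add: C1_in_time_def time_deriv_exp_separated)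
qed

text \<open>On an eigenfield of the Laplacian the heat flow acts by scalar decay, so time derivative and
  viscous term cancel. Advection is quadratic and decays at the doubled rate; pressure and force
  decay at that rate too, so the remaining balance at time \<open>t\<close> is the defining equation of \<open>F\<close> times a
  scalar.\<close>

lemma decaying_eigenfield_solves_navier_stokes:
  fixes v F :: "real ^ 'n::finite \<Rightarrow> real ^ 'n" and p :: "real ^ 'n \<Rightarrow> real"
  assumes v: "\<And>i. C1_fun (\<lambda>x. v x $ i)"
    and dv: "\<And>i j. C1_fun (partial_deriv j (\<lambda>x. v x $ i))"
    and p: "C1_fun p"
    and eigen: "\<And>i x. laplacian (\<lambda>y. v y $ i) x = - \<mu> * v x $ i"
    and div: "\<And>x. divergence v x = 0"
    and F: "\<And>i x. F x $ i = (1 / \<rho>) * partial_deriv i p x + advection v x $ i"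
  shows "navier_stokes_solution \<rho> \<kappa>
    (\<lambda>t x. exp (- 2 * \<mu> * \<kappa> * t) *\<^sub>R F x)
    (\<lambda>t x. exp (- \<mu> * \<kappa> * t) *\<^sub>R v x)
    (\<lambda>t x. p x * exp (- 2 * \<mu> * \<kappa> * t))"
proof -
  have dv_scaled: "partial_deriv j (\<lambda>x. c * v x $ i) = (\<lambda>x. c * partial_deriv j (\<lambda>y. v y $ i) x)"
    for c i j
    using v by (auto simp: C1_fun_def partial_deriv_cmult)
  have dp_scaled: "partial_deriv j (\<lambda>x. p x * c) x = c * partial_deriv j p x" for c j x
    using p by (simp add: C1_fun_def partial_deriv_cmult mult.commute[of _ c])
  have lap: "laplacian (\<lambda>y. c * v y $ i) x = - \<mu> * (c * v x $ i)" for c i x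
  proof -
    have "partial_deriv j (\<lambda>y. c * partial_deriv j (\<lambda>y. v y $ i) y) x =
        c * partial_deriv j (partial_deriv j (\<lambda>y. v y $ i)) x" for j
      using dv by (simp add: C1_fun_def partial_deriv_cmult)
    then have "laplacian (\<lambda>y. c * v y $ i) x = c * laplacian (\<lambda>y. v y $ i) x"
      by (simp add: laplacian_def dv_scaled sum_distrib_left)
    then show ?thesis by (simp add: eigen)
  qed
  have adv: "advection (\<lambda>x. c *\<^sub>R v x) x $ i = c\<^sup>2 * advection v x $ i" for c i x
    by (simp add: advection_def dv_scaled sum_distrib_left power2_eq_square mult_ac)
  have div_scaled: "divergence (\<lambda>x. c *\<^sub>R v x) x = 0" for c x
    using div[of x] by (simp add: divergence_def dv_scaled flip: sum_distrib_left)
  have square: "(exp (- \<mu> * \<kappa> * t))\<^sup>2 = exp (- 2 * \<mu> * \<kappa> * t)" for t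
    by (simp add: power2_eq_square algebra_simps flip: exp_add)
  have momentum: "time_deriv (\<lambda>s y. exp (- \<mu> * \<kappa> * s) * v y $ i) t x
      + advection (\<lambda>x. exp (- \<mu> * \<kappa> * t) *\<^sub>R v x) x $ i =
      \<kappa> * laplacian (\<lambda>y. exp (- \<mu> * \<kappa> * t) * v y $ i) x
      - (1 / \<rho>) * partial_deriv i (\<lambda>x. p x * exp (- 2 * \<mu> * \<kappa> * t)) x
      + exp (- 2 * \<mu> * \<kappa> * t) * F x $ i" if "t \<ge> 0" for i t x
    unfolding adv square lap dp_scaled F time_deriv_exp_separated(2)[OF that]
    by (simp add: algebra_simps)
  have "C1_in_space (\<lambda>t x. p x * exp (- 2 * \<mu> * \<kappa> * t))"
    using C1_in_space_separated[OF _ p, of "\<lambda>t. exp (- 2 * \<mu> * \<kappa> * t)"]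
    by (simp add: mult.commute[of "p _"] continuous_intros)
  moreover have "C1_in_time (\<lambda>t x. exp (- \<mu> * \<kappa> * t) * v x $ i)" for i
    using v by (intro C1_in_time_exp_separated) (auto simp: C1_fun_def)
  moreover have "C1_in_space (\<lambda>t x. exp (- \<mu> * \<kappa> * t) * v x $ i)" for i
    by (intro C1_in_space_separated v continuous_intros)
  moreover have "C1_in_space (\<lambda>t. partial_deriv j (\<lambda>x. exp (- \<mu> * \<kappa> * t) * v x $ i))" for i j
    unfolding dv_scaled by (intro C1_in_space_separated dv continuous_intros)
  ultimately show ?thesis
    using momentum div_scaled by (simp add: navier_stokes_solution_def)
qed

section \<open>Products of phase-shifted sines\<close>

definition sine_product :: "real \<Rightarrow> ('n::finite \<Rightarrow> real) \<Rightarrow> real ^ 'n \<Rightarrow> real" where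
  "sine_product \<alpha> \<phi> x = (\<Prod>k\<in>UNIV. sin (\<alpha> * x $ k + \<phi> k))"

text \<open>Only one factor depends on the \<open>j\<close>-th coordinate, and differentiating a sine advances its phase
  by a quarter turn. Thus the products are closed under partial differentiation up to scalars, which
  reduces the regularity of all their derivatives to the continuity of the products.\<close>

lemma sine_product_partial:
  fixes \<phi> :: "'n::finite \<Rightarrow> real"
  shows "has_partial j (sine_product \<alpha> \<phi>) x"
    and "partial_deriv j (sine_product \<alpha> \<phi>) x = \<alpha> * sine_product \<alpha> (\<phi>(j := \<phi> j + pi / 2)) x"
proof -
  define R where "R = (\<Prod>k\<in>UNIV - {j}. sin (\<alpha> * x $ k + \<phi> k))"
  have "sine_product \<alpha> \<phi> (x + h *\<^sub>R axis j 1) = sin (\<alpha> * (x $ j + h) + \<phi> j) * R" for h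
    unfolding sine_product_def R_def
    by (subst prod.remove[of UNIV j]) (auto simp: axis_def intro!: prod.cong)
  moreover have "sine_product \<alpha> (\<phi>(j := \<phi> j + pi / 2)) x = cos (\<alpha> * x $ j + \<phi> j) * R"
    unfolding sine_product_def R_def
    by (subst prod.remove[of UNIV j]) (auto simp: sin_cos_eq[symmetric] sin_add cos_add intro!: prod.cong)
  moreover have "((\<lambda>h. sin (\<alpha> * (x $ j + h) + \<phi> j) * R) has_field_derivative
      \<alpha> * (cos (\<alpha> * x $ j + \<phi> j) * R)) (at 0)"
    by (auto intro!: derivative_eq_intros)
  ultimately have "((\<lambda>h. sine_product \<alpha> \<phi> (x + h *\<^sub>R axis j 1)) has_field_derivative
      \<alpha> * sine_product \<alpha> (\<phi>(j := \<phi> j + pi / 2)) x) (at 0)"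
    by simp
  then show "has_partial j (sine_product \<alpha> \<phi>) x"
    and "partial_deriv j (sine_product \<alpha> \<phi>) x = \<alpha> * sine_product \<alpha> (\<phi>(j := \<phi> j + pi / 2)) x"
    by (rule partial_derivI)+
qed

lemma C1_fun_sine_product: "C1_fun (sine_product \<alpha> \<phi>)"
proof -
  have "continuous_on UNIV (sine_product \<alpha> \<psi>)" for \<psi> :: "'a \<Rightarrow> real"
    unfolding sine_product_def by (intro continuous_intros)
  moreover have "partial_deriv j (sine_product \<alpha> \<phi>) =
      (\<lambda>x. \<alpha> * sine_product \<alpha> (\<phi>(j := \<phi> j + pi / 2)) x)" for j
    by (auto simp: sine_product_partial)
  ultimately show ?thesis
    by (auto simp: C1_fun_def sine_product_partial intro!: continuous_intros)
qed

lemma sine_product_half_turn: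
  "sine_product \<alpha> (\<phi>(j := \<phi> j + pi)) x = - sine_product \<alpha> \<phi> x"
  unfolding sine_product_def
  by (subst (1 2) prod.remove[of UNIV j]) (auto simp: add.assoc[symmetric] intro!: prod.cong)

lemma partial_deriv_sine_difference:
  "partial_deriv j (\<lambda>x. c * (sine_product \<alpha> \<phi> x - sine_product \<alpha> \<psi> x)) =
    (\<lambda>x. c * \<alpha> * (sine_product \<alpha> (\<phi>(j := \<phi> j + pi / 2)) x
      - sine_product \<alpha> (\<psi>(j := \<psi> j + pi / 2)) x))"
  by (rule ext, simp add: partial_deriv_cmult partial_deriv_diff has_partial_diff sine_product_partial)
     (simp add: algebra_simps)

lemma C1_fun_sine_difference:
  "C1_fun (\<lambda>x. c * (sine_product \<alpha> \<phi> x - sine_product \<alpha> \<psi> x))"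
  by (intro C1_fun_cmult C1_fun_diff C1_fun_sine_product)

text \<open>Two quarter turns of the same phase change the sign, so each \<open>\<partial>\<^sub>j\<^sup>2\<close> acts as \<open>- \<alpha>\<^sup>2\<close>.\<close>

lemma laplacian_sine_difference:
  fixes \<alpha> :: real and \<phi> \<psi> :: "'n::finite \<Rightarrow> real"
  shows "laplacian (\<lambda>x. c * (sine_product \<alpha> \<phi> x - sine_product \<alpha> \<psi> x)) x =
    - (CARD('n) * \<alpha>\<^sup>2) * (c * (sine_product \<alpha> \<phi> x - sine_product \<alpha> \<psi> x))"
proof -
  have "partial_deriv j (partial_deriv j (\<lambda>x. c * (sine_product \<alpha> \<phi> x - sine_product \<alpha> \<psi> x))) x =
      - (\<alpha>\<^sup>2) * (c * (sine_product \<alpha> \<phi> x - sine_product \<alpha> \<psi> x))" for j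
    using sine_product_half_turn[of \<alpha> \<phi> j x] sine_product_half_turn[of \<alpha> \<psi> j x]
    unfolding partial_deriv_sine_difference by (simp add: algebra_simps power2_eq_square)
  then show ?thesis by (simp add: laplacian_def)
qed

section \<open>The field as a difference of two sine products\<close>

text \<open>Index arithmetic in the type \<open>6\<close> is cyclic, so sums and products over all coordinates may start at
  any coordinate \<open>i\<close>. The expansions below are used with \<open>i\<close> the component under consideration.\<close>

lemma UNIV_6_shift: "(UNIV :: 6 set) = {i, i + 1, i + 2, i + 3, i + 4, i + 5}"
proof -
  have "card {i, i + 1, i + 2, i + 3, i + 4, i + 5} = 6" by simp
  then show ?thesis by (intro card_subset_eq[symmetric]) auto
qed

lemma sum_UNIV_6_shift:
  fixes f :: "6 \<Rightarrow> 'a::comm_monoid_add"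
  shows "sum f UNIV = f i + f (i + 1) + f (i + 2) + f (i + 3) + f (i + 4) + f (i + 5)"
  by (subst UNIV_6_shift[of i]) (simp add: add_ac)

lemma prod_UNIV_6_shift:
  fixes f :: "6 \<Rightarrow> 'a::comm_monoid_mult"
  shows "prod f UNIV = f i * f (i + 1) * f (i + 2) * f (i + 3) * f (i + 4) * f (i + 5)"
  by (subst UNIV_6_shift[of i]) (simp add: mult_ac)

lemma numeral_mod_6:
  "(6::6) = 0" "(7::6) = 1" "(8::6) = 2" "(9::6) = 3" "(10::6) = 4"
  by simp_all

lemma v0_coordinate_index:
  fixes i :: 6
  shows "i + 1 - 1 = i" "i + 2 - 1 = i + 1" "i + 3 - 1 = i + 2" "i + 4 - 1 = i + 3"
    "i + 5 - 1 = i + 4" "i + 6 - 1 = i + 5"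
  by (simp_all add: diff_conv_add_uminus add.assoc del: add_uminus_conv_diff)

text \<open>Phase of the factor in coordinate \<open>k\<close> of the two products that make up component \<open>i\<close>. The listed
  offsets \<open>k - i\<close> are those of the sine factors; the others are cosines. The second product uses
  the phase vector advanced by one position.\<close>

definition first_phases :: "real ^ 6 \<Rightarrow> 6 \<Rightarrow> 6 \<Rightarrow> real" where
  "first_phases \<xi> i k = \<xi> $ (k - i + 1) + (if k - i \<in> {0, 2, 4} then 0 else pi / 2)"

definition second_phases :: "real ^ 6 \<Rightarrow> 6 \<Rightarrow> 6 \<Rightarrow> real" where
  "second_phases \<xi> i k = \<xi> $ (k - i + 2) + (if k - i \<in> {0, 1, 3} then 0 else pi / 2)"

lemma v0_sine_products:
  "v0 \<alpha> c \<xi> x $ i =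
    c * (sine_product \<alpha> (first_phases \<xi> i) x - sine_product \<alpha> (second_phases \<xi> i) x)"
proof -
  have quarter: "sin (a + (b + pi / 2)) = cos (a + b)" for a b :: real
    by (simp add: sin_add cos_add)
  show ?thesis
    unfolding v0_def v0_first_def sine_product_def prod_UNIV_6_shift[of _ i]
    by (simp only: vec_lambda_beta v0_coordinate_index)
       (simp add: first_phases_def second_phases_def quarter numeral_mod_6)
qed

text \<open>Differentiation along \<open>i\<close> turns the sine at offset \<open>0\<close> of the first product into a cosine and
  leaves sines at offsets \<open>2\<close> and \<open>4\<close>. In the second product of component \<open>i + 1\<close> the sines at
  offsets \<open>1\<close> and \<open>3\<close> remain, which are the same coordinates, and the advanced phase vector
  compensates the shift of the component.\<close>

lemma v0_diagonal_phases:
  "(first_phases \<xi> i)(i := first_phases \<xi> i i + pi / 2) =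
   (second_phases \<xi> (i + 1))(i + 1 := second_phases \<xi> (i + 1) (i + 1) + pi / 2)"
proof
  fix k :: 6
  have "k \<in> {i, i + 1, i + 2, i + 3, i + 4, i + 5}"
    using UNIV_6_shift[of i] by blast
  then show "((first_phases \<xi> i)(i := first_phases \<xi> i i + pi / 2)) k =
   ((second_phases \<xi> (i + 1))(i + 1 := second_phases \<xi> (i + 1) (i + 1) + pi / 2)) k"
    by (auto simp: first_phases_def second_phases_def numeral_mod_6)
qed

text \<open>The diagonal derivatives telescope around the cycle of coordinates.\<close>

lemma divergence_v0: "divergence (v0 \<alpha> c \<xi>) x = 0"
proof -
  define A where "A i = sine_product \<alpha> ((second_phases \<xi> i)(i := second_phases \<xi> i i + pi / 2)) x" for i
  have "divergence (v0 \<alpha> c \<xi>) x = (\<Sum>i\<in>UNIV. c * \<alpha> * (A (i + 1) - A i))"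
    by (simp add: divergence_def v0_sine_products partial_deriv_sine_difference v0_diagonal_phases A_def)
  also have "\<dots> = c * \<alpha> * ((\<Sum>i\<in>UNIV. A (i + 1)) - (\<Sum>i\<in>UNIV. A i))"
    by (simp add: sum_subtractf flip: sum_distrib_left)
  also have "(\<Sum>i\<in>UNIV. A (i + 1)) = (\<Sum>i\<in>UNIV. A i)"
    by (rule sum.reindex_bij_witness[of _ "\<lambda>i. i - 1" "\<lambda>i. i + 1"]) auto
  finally show ?thesis by simp
qed

section \<open>The force at the symmetric phases\<close>

lemma shift_minus_eighth_turn:
  fixes t :: real
  shows "sin (t - pi / 4) = - cos (t + pi / 4)" and "cos (t - pi / 4) = sin (t + pi / 4)"
  by (simp_all add: sin_add cos_add sin_diff cos_diff sin_45 cos_45)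

text \<open>The exceptional phase \<open>- \<pi>/4\<close> differs from \<open>\<pi>/4\<close> by a quarter turn. It exchanges sine and cosine
  in one factor of each product, after which the second product is the first one with all sines
  and cosines interchanged.\<close>

lemma v0_symmetric:
  fixes \<alpha> c :: real and x :: "real ^ 6"
  defines "S \<equiv> \<lambda>k. sin (\<alpha> * x $ k + pi / 4)" and "C \<equiv> \<lambda>k. cos (\<alpha> * x $ k + pi / 4)"
  shows "v0 \<alpha> c symmetric_phases x $ i = - c *
    (C i * C (i + 1) * S (i + 2) * C (i + 3) * S (i + 4) * C (i + 5)
     + S i * S (i + 1) * C (i + 2) * S (i + 3) * C (i + 4) * S (i + 5))"
  unfolding v0_def v0_first_def
  by (simp only: vec_lambda_beta v0_coordinate_index)
     (simp add: symmetric_phases_def shift_minus_eighth_turn S_def C_def algebra_simps)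

lemma partial_deriv_v0_symmetric:
  fixes \<alpha> c :: real and x :: "real ^ 6" and i j :: 6
  defines "S \<equiv> \<lambda>k. sin (\<alpha> * x $ k + pi / 4)" and "C \<equiv> \<lambda>k. cos (\<alpha> * x $ k + pi / 4)"
  defines "dS \<equiv> \<lambda>k. if k = j then C k else 0" and "dC \<equiv> \<lambda>k. if k = j then - S k else 0"
  shows "partial_deriv j (\<lambda>y. v0 \<alpha> c symmetric_phases y $ i) x = - c * \<alpha> *
    (dC i * C (i + 1) * S (i + 2) * C (i + 3) * S (i + 4) * C (i + 5)
     + C i * dC (i + 1) * S (i + 2) * C (i + 3) * S (i + 4) * C (i + 5)
     + C i * C (i + 1) * dS (i + 2) * C (i + 3) * S (i + 4) * C (i + 5)
     + C i * C (i + 1) * S (i + 2) * dC (i + 3) * S (i + 4) * C (i + 5)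
     + C i * C (i + 1) * S (i + 2) * C (i + 3) * dS (i + 4) * C (i + 5)
     + C i * C (i + 1) * S (i + 2) * C (i + 3) * S (i + 4) * dC (i + 5)
     + dS i * S (i + 1) * C (i + 2) * S (i + 3) * C (i + 4) * S (i + 5)
     + S i * dS (i + 1) * C (i + 2) * S (i + 3) * C (i + 4) * S (i + 5)
     + S i * S (i + 1) * dC (i + 2) * S (i + 3) * C (i + 4) * S (i + 5)
     + S i * S (i + 1) * C (i + 2) * dS (i + 3) * C (i + 4) * S (i + 5)
     + S i * S (i + 1) * C (i + 2) * S (i + 3) * dC (i + 4) * S (i + 5)
     + S i * S (i + 1) * C (i + 2) * S (i + 3) * C (i + 4) * dS (i + 5))"
proof -
  define S' where "S' k h = sin (\<alpha> * (x + h *\<^sub>R axis j 1) $ k + pi / 4)" for k h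
  define C' where "C' k h = cos (\<alpha> * (x + h *\<^sub>R axis j 1) $ k + pi / 4)" for k h
  have at_0: "S' k 0 = S k" "C' k 0 = C k" for k
    by (simp_all add: S'_def C'_def S_def C_def)
  have [derivative_intros]:
    "(S' k has_field_derivative \<alpha> * dS k) (at 0)" "(C' k has_field_derivative \<alpha> * dC k) (at 0)" for k
    unfolding S'_def C'_def
    by (auto intro!: derivative_eq_intros simp: dS_def dC_def S_def C_def axis_def)
  show ?thesis
    unfolding v0_symmetric
    by (rule partial_derivI(2), unfold S'_def[symmetric] C'_def[symmetric],
        (rule derivative_eq_intros refl)+, unfold at_0) algebra
qed

text \<open>Up to the factor \<open>\<alpha> c\<^sup>2\<close>, the left-hand side is eight times the advection of a component as a
  polynomial in the sines and cosines of the shifted coordinates, where \<open>S\<close> and \<open>C\<close> carry the offset of the coordinate. It is homogeneous of degree two in each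
  pair \<open>(Sk, Ck)\<close>. Padding the right-hand side with the factors \<open>Sk\<^sup>2 + Ck\<^sup>2 = 1\<close> gives it the same
  multidegree; a form of degree two is determined by its values on the circle, so the
  trigonometric identity becomes an identity in the polynomial ring.\<close>

lemma v0_product_identity:
  fixes S0 S1 S2 S3 S4 S5 C0 C1 C2 C3 C4 C5 :: real
  shows "8 * ((C0*C1*S2*C3*S4*C5 + S0*S1*C2*S3*C4*S5) * (- S0*C1*S2*C3*S4*C5 + C0*S1*C2*S3*C4*S5)
   + (C1*C2*S3*C4*S5*C0 + S1*S2*C3*S4*C5*S0) * (- C0*S1*S2*C3*S4*C5 + S0*C1*C2*S3*C4*S5)
   + (C2*C3*S4*C5*S0*C1 + S2*S3*C4*S5*C0*S1) * (C0*C1*C2*C3*S4*C5 - S0*S1*S2*S3*C4*S5)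
   + (C3*C4*S5*C0*S1*C2 + S3*S4*C5*S0*C1*S2) * (- C0*C1*S2*S3*S4*C5 + S0*S1*C2*C3*C4*S5)
   + (C4*C5*S0*C1*S2*C3 + S4*S5*C0*S1*C2*S3) * (C0*C1*S2*C3*C4*C5 - S0*S1*C2*S3*S4*S5)
   + (C5*C0*S1*C2*S3*C4 + S5*S0*C1*S2*C3*S4) * (- C0*C1*S2*C3*S4*S5 + S0*S1*C2*S3*C4*C5))
   = - (2*S0*C0) *
     ((S2\<^sup>2-C2\<^sup>2)*(S1\<^sup>2+C1\<^sup>2)*(S3\<^sup>2+C3\<^sup>2)*(S4\<^sup>2+C4\<^sup>2)*(S5\<^sup>2+C5\<^sup>2)
     + (S4\<^sup>2-C4\<^sup>2)*(S1\<^sup>2+C1\<^sup>2)*(S2\<^sup>2+C2\<^sup>2)*(S3\<^sup>2+C3\<^sup>2)*(S5\<^sup>2+C5\<^sup>2)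
     + (S1\<^sup>2-C1\<^sup>2)*(S3\<^sup>2-C3\<^sup>2)*(S5\<^sup>2-C5\<^sup>2)*(S2\<^sup>2+C2\<^sup>2)*(S4\<^sup>2+C4\<^sup>2)
     - (S2\<^sup>2-C2\<^sup>2)*(S4\<^sup>2-C4\<^sup>2)*
       ((S1\<^sup>2-C1\<^sup>2)*(S3\<^sup>2+C3\<^sup>2)*(S5\<^sup>2+C5\<^sup>2)
       + (S3\<^sup>2-C3\<^sup>2)*(S1\<^sup>2+C1\<^sup>2)*(S5\<^sup>2+C5\<^sup>2)
       + (S5\<^sup>2-C5\<^sup>2)*(S1\<^sup>2+C1\<^sup>2)*(S3\<^sup>2+C3\<^sup>2)))"
  by algebra

lemma advection_v0_symmetric:
  fixes \<alpha> c :: real and x :: "real ^ 6"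
  defines "s \<equiv> \<lambda>k. sin (2 * \<alpha> * x $ k)"
  shows "advection (v0 \<alpha> c symmetric_phases) x $ i =
    - (\<alpha> * c\<^sup>2 / 8) * cos (2 * \<alpha> * x $ i) *
      (s (i + 2) + s (i + 4) + s (i + 1) * s (i + 3) * s (i + 5)
       - s (i + 2) * s (i + 4) * (s (i + 1) + s (i + 3) + s (i + 5)))"
proof -
  define S where "S k = sin (\<alpha> * x $ k + pi / 4)" for k
  define C where "C k = cos (\<alpha> * x $ k + pi / 4)" for k
  have double: "2 * (\<alpha> * x $ k + pi / 4) = 2 * \<alpha> * x $ k + pi / 2" for k
    by (simp add: algebra_simps)
  have s: "s k = (S k)\<^sup>2 - (C k)\<^sup>2" for k
    using cos_double[of "\<alpha> * x $ k + pi / 4"] unfolding double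
    by (simp add: s_def S_def C_def cos_add)
  have c: "cos (2 * \<alpha> * x $ i) = 2 * S i * C i"
    using sin_double[of "\<alpha> * x $ i + pi / 4"] unfolding double
    by (simp add: S_def C_def sin_add)
  have eighth: "8 * g = r \<Longrightarrow> g = r / 8" for g r :: real by simp
  have one: "(S k)\<^sup>2 + (C k)\<^sup>2 = 1" for k by (simp add: S_def C_def)
  have "advection (v0 \<alpha> c symmetric_phases) x $ i = \<alpha> * c\<^sup>2 *
   ((C i*C (i+1)*S (i+2)*C (i+3)*S (i+4)*C (i+5) + S i*S (i+1)*C (i+2)*S (i+3)*C (i+4)*S (i+5))
     * (- S i*C (i+1)*S (i+2)*C (i+3)*S (i+4)*C (i+5) + C i*S (i+1)*C (i+2)*S (i+3)*C (i+4)*S (i+5))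
   + (C (i+1)*C (i+2)*S (i+3)*C (i+4)*S (i+5)*C i + S (i+1)*S (i+2)*C (i+3)*S (i+4)*C (i+5)*S i)
     * (- C i*S (i+1)*S (i+2)*C (i+3)*S (i+4)*C (i+5) + S i*C (i+1)*C (i+2)*S (i+3)*C (i+4)*S (i+5))
   + (C (i+2)*C (i+3)*S (i+4)*C (i+5)*S i*C (i+1) + S (i+2)*S (i+3)*C (i+4)*S (i+5)*C i*S (i+1))
     * (C i*C (i+1)*C (i+2)*C (i+3)*S (i+4)*C (i+5) - S i*S (i+1)*S (i+2)*S (i+3)*C (i+4)*S (i+5))
   + (C (i+3)*C (i+4)*S (i+5)*C i*S (i+1)*C (i+2) + S (i+3)*S (i+4)*C (i+5)*S i*C (i+1)*S (i+2))
     * (- C i*C (i+1)*S (i+2)*S (i+3)*S (i+4)*C (i+5) + S i*S (i+1)*C (i+2)*C (i+3)*C (i+4)*S (i+5))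
   + (C (i+4)*C (i+5)*S i*C (i+1)*S (i+2)*C (i+3) + S (i+4)*S (i+5)*C i*S (i+1)*C (i+2)*S (i+3))
     * (C i*C (i+1)*S (i+2)*C (i+3)*C (i+4)*C (i+5) - S i*S (i+1)*C (i+2)*S (i+3)*S (i+4)*S (i+5))
   + (C (i+5)*C i*S (i+1)*C (i+2)*S (i+3)*C (i+4) + S (i+5)*S i*C (i+1)*S (i+2)*C (i+3)*S (i+4))
     * (- C i*C (i+1)*S (i+2)*C (i+3)*S (i+4)*S (i+5) + S i*S (i+1)*C (i+2)*S (i+3)*C (i+4)*C (i+5)))"
    (is "_ = \<alpha> * c\<^sup>2 * ?G")
    unfolding advection_def vec_lambda_beta sum_UNIV_6_shift[of _ i]
      partial_deriv_v0_symmetric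
    unfolding v0_symmetric S_def[symmetric] C_def[symmetric]
    by (simp add: add.assoc[of i] numeral_mod_6) algebra
  also have "?G = ( - cos (2 * \<alpha> * x $ i) *
      (s (i + 2) + s (i + 4) + s (i + 1) * s (i + 3) * s (i + 5)
       - s (i + 2) * s (i + 4) * (s (i + 1) + s (i + 3) + s (i + 5)))) / 8"
    using v0_product_identity[of "C i" "C (i+1)" "S (i+2)" "C (i+3)" "S (i+4)" "C (i+5)"
        "S i" "S (i+1)" "C (i+2)" "S (i+3)" "C (i+4)" "S (i+5)"]
    unfolding one s[symmetric] c by (intro eighth) (simp only: mult_1_right)
  finally show ?thesis by simp
qed

text \<open>The six quadratic and the six quartic monomials of the pressure each form one orbit under cyclic
  shifts, which makes its gradient computable for all components at once.\<close>

lemma pstar_cyclic: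
  fixes \<alpha> :: real and x :: "real ^ 6"
  defines "s \<equiv> \<lambda>k. sin (2 * \<alpha> * x $ k)"
  shows "pstar \<rho> \<alpha> c x = \<rho> * c\<^sup>2 / 16 *
    (\<Sum>k\<in>UNIV. s k * s (k + 2) * (1 - s (k + 1) * s (k + 4)))"
  unfolding sum_UNIV_6_shift[of _ 1] pstar_def s_def
  by (simp add: Let_def numeral_mod_6 algebra_simps)

lemma pstar_partial:
  fixes \<rho> \<alpha> c :: real and x :: "real ^ 6" and j :: 6
  defines "s \<equiv> \<lambda>k. sin (2 * \<alpha> * x $ k)"
  defines "d \<equiv> \<lambda>k. if k = j then 2 * \<alpha> * cos (2 * \<alpha> * x $ k) else 0"
  defines "D \<equiv> \<rho> * c\<^sup>2 / 16 * (\<Sum>k\<in>UNIV.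
    (d k * s (k + 2) + s k * d (k + 2)) * (1 - s (k + 1) * s (k + 4))
    - s k * s (k + 2) * (d (k + 1) * s (k + 4) + s (k + 1) * d (k + 4)))"
  shows "has_partial j (pstar \<rho> \<alpha> c) x" and "partial_deriv j (pstar \<rho> \<alpha> c) x = D"
proof -
  define s' where "s' k h = sin (2 * \<alpha> * (x + h *\<^sub>R axis j 1) $ k)" for k h
  have at_0: "s' k 0 = s k" for k
    by (simp add: s'_def s_def)
  have [derivative_intros]: "(s' k has_field_derivative d k) (at 0)" for k
    unfolding s'_def by (auto intro!: derivative_eq_intros simp: d_def axis_def)
  have "((\<lambda>h. pstar \<rho> \<alpha> c (x + h *\<^sub>R axis j 1)) has_field_derivative D) (at 0)"
    unfolding pstar_cyclic D_def s'_def[symmetric]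
    by ((rule derivative_eq_intros refl)+, unfold at_0) (simp add: algebra_simps)
  then show "has_partial j (pstar \<rho> \<alpha> c) x" and "partial_deriv j (pstar \<rho> \<alpha> c) x = D"
    by (rule partial_derivI)+
qed

lemma C1_fun_pstar: "C1_fun (pstar \<rho> \<alpha> c)"
proof -
  have "continuous_on UNIV (pstar \<rho> \<alpha> c)"
    unfolding pstar_def Let_def by (intro continuous_intros)
  moreover have "continuous_on UNIV (partial_deriv j (pstar \<rho> \<alpha> c))" for j
  proof -
    have "continuous_on UNIV (\<lambda>x::real ^ 6. if k = j then 2 * \<alpha> * cos (2 * \<alpha> * x $ k) else 0)" for k
      by (cases "k = j") (auto intro!: continuous_intros)
    then have "continuous_on UNIV (\<lambda>x. partial_deriv j (pstar \<rho> \<alpha> c) x)"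
      unfolding pstar_partial(2) by (intro continuous_intros)
    then show ?thesis by simp
  qed
  ultimately show ?thesis by (simp add: C1_fun_def pstar_partial(1))
qed

lemma pstar_gradient:
  fixes \<alpha> :: real and x :: "real ^ 6"
  defines "s \<equiv> \<lambda>k. sin (2 * \<alpha> * x $ k)"
  shows "partial_deriv i (pstar \<rho> \<alpha> c) x = \<rho> * \<alpha> * c\<^sup>2 / 8 * cos (2 * \<alpha> * x $ i) *
    (s (i + 2) + s (i + 4) - s (i + 1) * s (i + 2) * s (i + 4) - s (i + 1) * s (i + 3) * s (i + 5)
     - s (i + 2) * s (i + 4) * s (i + 5) - s (i + 2) * s (i + 3) * s (i + 4))"
  unfolding pstar_partial(2) sum_UNIV_6_shift[of _ i] s_def
  by (simp add: add.assoc[of i] numeral_mod_6) algebra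

text \<open>Apart from the common factor \<open>\<alpha> c\<^sup>2 cos (2 \<alpha> x\<^sub>i)\<close>, the linear terms and the cubic terms
  containing both offsets \<open>2\<close> and \<open>4\<close> occur with opposite coefficients in \<open>1/\<rho>\<close> times the pressure
  gradient and in the advection, whereas the product over the odd offsets occurs with coefficient
  \<open>- 1 / 8\<close> in both.\<close>

lemma f0_closed_form:
  fixes \<alpha> :: real and x :: "real ^ 6"
  assumes "\<rho> \<noteq> 0"
  shows "f0 \<rho> \<alpha> c x $ i = - (\<alpha> * c\<^sup>2 / 4) * cos (2 * \<alpha> * x $ i) *
    (sin (2 * \<alpha> * x $ (i + 1)) * sin (2 * \<alpha> * x $ (i + 3)) * sin (2 * \<alpha> * x $ (i + 5)))"
  using assms
  by (simp add: f0_def pstar_gradient advection_v0_symmetric field_simps)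

theorem proposition6p5:
  fixes \<alpha> v\<^sub>r \<rho> \<kappa> :: real
  assumes "\<alpha> > 0" and "v\<^sub>r > 0" and "\<rho> > 0" and "\<kappa> > 0"
  shows "(\<forall>(x :: real ^ 6) (i :: 6).
            f0 \<rho> \<alpha> v\<^sub>r x $ i =
              - (\<alpha> * v\<^sub>r\<^sup>2 / 4) * cos (2 * \<alpha> * x $ i) *
                (\<Prod>j\<in>{1..3::nat}. sin (2 * \<alpha> * x $ (i + 2 * of_nat j - 1)))) \<and>
         navier_stokes_solution \<rho> \<kappa>
           (\<lambda>t x. exp (- 12 * \<alpha>\<^sup>2 * \<kappa> * t) *\<^sub>R f0 \<rho> \<alpha> v\<^sub>r x)
           (\<lambda>t x. exp (- 6 * \<alpha>\<^sup>2 * \<kappa> * t) *\<^sub>R v0 \<alpha> v\<^sub>r symmetric_phases x)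
           (\<lambda>t x. pstar \<rho> \<alpha> v\<^sub>r x * exp (- 12 * \<alpha>\<^sup>2 * \<kappa> * t))"
proof (intro conjI allI)
  fix x :: "real ^ 6" and i :: 6
  have "{1..3::nat} = {1, 2, 3}" by auto
  then have "(\<Prod>j\<in>{1..3::nat}. sin (2 * \<alpha> * x $ (i + 2 * of_nat j - 1))) =
      sin (2 * \<alpha> * x $ (i + 2 - 1)) * sin (2 * \<alpha> * x $ (i + 4 - 1)) * sin (2 * \<alpha> * x $ (i + 6 - 1))"
    by simp
  then show "f0 \<rho> \<alpha> v\<^sub>r x $ i = - (\<alpha> * v\<^sub>r\<^sup>2 / 4) * cos (2 * \<alpha> * x $ i) *
      (\<Prod>j\<in>{1..3::nat}. sin (2 * \<alpha> * x $ (i + 2 * of_nat j - 1)))"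
    using f0_closed_form[of \<rho> \<alpha> v\<^sub>r x i] \<open>\<rho> > 0\<close> by (simp only: v0_coordinate_index)
next
  have "navier_stokes_solution \<rho> \<kappa>
    (\<lambda>t x. exp (- 2 * (6 * \<alpha>\<^sup>2) * \<kappa> * t) *\<^sub>R f0 \<rho> \<alpha> v\<^sub>r x)
    (\<lambda>t x. exp (- (6 * \<alpha>\<^sup>2) * \<kappa> * t) *\<^sub>R v0 \<alpha> v\<^sub>r symmetric_phases x)
    (\<lambda>t x. pstar \<rho> \<alpha> v\<^sub>r x * exp (- 2 * (6 * \<alpha>\<^sup>2) * \<kappa> * t))"
  proof (rule decaying_eigenfield_solves_navier_stokes)
    show "laplacian (\<lambda>y. v0 \<alpha> v\<^sub>r symmetric_phases y $ i) x =
        - (6 * \<alpha>\<^sup>2) * v0 \<alpha> v\<^sub>r symmetric_phases x $ i" for i x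
      by (simp add: v0_sine_products laplacian_sine_difference)
  qed (simp_all add: v0_sine_products partial_deriv_sine_difference C1_fun_sine_difference
      C1_fun_pstar divergence_v0 f0_def)
  then show "navier_stokes_solution \<rho> \<kappa>
    (\<lambda>t x. exp (- 12 * \<alpha>\<^sup>2 * \<kappa> * t) *\<^sub>R f0 \<rho> \<alpha> v\<^sub>r x)
    (\<lambda>t x. exp (- 6 * \<alpha>\<^sup>2 * \<kappa> * t) *\<^sub>R v0 \<alpha> v\<^sub>r symmetric_phases x)
    (\<lambda>t x. pstar \<rho> \<alpha> v\<^sub>r x * exp (- 12 * \<alpha>\<^sup>2 * \<kappa> * t))"
    by simp
qed

end
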